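(* For every integer $d\ge 2$ there is a constant $C(d)>0$, depending only on $d$, such that for every $n\ge1$, every real multi-indexed matrix $A=(a_{\mathbf i})_{1\le i_1,\dots,i_d\le n}$ of order $d$ and every real $p\ge 2$, $$\mathbf E\left\|\left(\sum_{i_d}a_{\mathbf i}\,g_{i_d}\right)_{i_1,\dots,i_{d-1}}\right\|_{\{1\}\dots\{d-1\}}\le C(d)\,p^{(1-d)/2}\,m_p(A),$$ where $g_1,\dots,g_n$ are independent standard $\mathcal N(0,1)$ random variables.
   Context: A matrix of order $d$ is a finite real array $A=(a_{\mathbf i})$ indexed by $\mathbf i=(i_1,\dots,i_d)\in\{1,\dots,n\}^d$. For $I\subset\{1,\dots,d\}$ put $i_I:=(i_j)_{j\in I}$. For a partition of $\{1,\dots,d\}$ into nonempty disjoint sets $I_1,\dots,I_k$ put $$\|A\|_{I_1,\dots,I_k}:=\sup\Big\{\sum_{\mathbf i}a_{\mathbf i}\,x^{(1)}_{i_{I_1}}\cdots x^{(k)}_{i_{I_k}}:\ \sum_{i_{I_1}}(x^{(1)}_{i_{I_1}})^2\le 1,\dots,\sum_{i_{I_k}}(x^{(k)}_{i_{I_k}})^2\le 1\Big\},$$ where each $x^{(l)}=(x^{(l)}_{i_{I_l}})$ is a real array indexed by $i_{I_l}\in\{1,\dots,n\}^{I_l}$. In particular, for a matrix $B=(b_{i_1,\dots,i_{d-1}})$ of order $d-1$, $\|B\|_{\{1\}\dots\{d-1\}}=\sup\{\sum b_{i_1,\dots,i_{d-1}}x^1_{i_1}\cdots x^{d-1}_{i_{d-1}}:\|x^1\|_2\le1,\dots,\|x^{d-1}\|_2\le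 1\}$. Let $S(k,d)$ be the set of all partitions of $\{1,\dots,d\}$ into $k$ nonempty disjoint sets $I_1,\dots,I_k$. For $p\ge 1$, $$m_p(A):=\sum_{k=1}^d p^{k/2}\sum_{(I_1,\dots,I_k)\in S(k,d)}\|A\|_{I_1,\dots,I_k}.$$ *)

theory Defs
  imports "HOL-Probability.Probability"
begin

text \<open>
  A multi-index \<open>i\<^sub>I\<close> is an extensional function on \<open>I\<close> with values in \<open>{1..n}\<close>. A matrix of order
  \<open>d\<close> is a function on multi-indices of which only the values on \<open>multi_indices n {1..d}\<close> matter.
\<close>

definition multi_indices :: "nat \<Rightarrow> nat set \<Rightarrow> (nat \<Rightarrow> nat) set" where
  "multi_indices n I = I \<rightarrow>\<^sub>E {1..n}"

definition partition_norm :: "nat \<Rightarrow> nat \<Rightarrow> nat set set \<Rightarrow> ((nat \<Rightarrow> nat) \<Rightarrow> real) \<Rightarrow> real" where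
  "partition_norm n d P A =
     Sup {(\<Sum>i\<in>multi_indices n {1..d}. A i * (\<Prod>I\<in>P. x I (restrict i I))) | x.
            \<forall>I\<in>P. (\<Sum>j\<in>multi_indices n I. (x I j)\<^sup>2) \<le> 1}"

definition partitions :: "nat \<Rightarrow> nat \<Rightarrow> nat set set set" where
  "partitions k d = {P. partition_on {1..d} P \<and> card P = k}"

definition singletons :: "nat \<Rightarrow> nat set set" where
  "singletons d = (\<lambda>j. {j}) ` {1..d}"

definition moment :: "nat \<Rightarrow> nat \<Rightarrow> real \<Rightarrow> ((nat \<Rightarrow> nat) \<Rightarrow> real) \<Rightarrow> real" where
  "moment n d p A =
     (\<Sum>k=1..d. p powr (real k / 2) * (\<Sum>P\<in>partitions k d. partition_norm n d P A))"

text \<open>The order \<open>d - 1\<close> matrix obtained by summing out the last index of \<open>A\<close> against \<open>y\<close>.\<close>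

definition contract_last :: "nat \<Rightarrow> nat \<Rightarrow> ((nat \<Rightarrow> nat) \<Rightarrow> real) \<Rightarrow> (nat \<Rightarrow> real) \<Rightarrow> (nat \<Rightarrow> nat) \<Rightarrow> real" where
  "contract_last n d A y = (\<lambda>i. \<Sum>j=1..n. A (i(d := j)) * y j)"

text \<open>The supremum defining \<^const>\<open>partition_norm\<close> is over a nonempty set that is bounded above, so
  the unspecified values of \<^const>\<open>Sup\<close> on the reals do not intervene.\<close>

lemma partition_norm_set_nonempty:
  "{(\<Sum>i\<in>multi_indices n {1..d}. A i * (\<Prod>I\<in>P. x I (restrict i I))) | x.
      \<forall>I\<in>P. (\<Sum>j\<in>multi_indices n I. (x I j)\<^sup>2) \<le> (1::real)} \<noteq> {}"
  by (auto intro!: exI[where x = "\<lambda>_ _. 0"])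

lemma partition_norm_set_bdd_above:
  assumes "partition_on {1..d} P"
  shows "bdd_above {(\<Sum>i\<in>multi_indices n {1..d}. A i * (\<Prod>I\<in>P. x I (restrict i I))) | x.
      \<forall>I\<in>P. (\<Sum>j\<in>multi_indices n I. (x I j)\<^sup>2) \<le> (1::real)}"
proof (rule bdd_aboveI, clarify)
  fix x :: "nat set \<Rightarrow> (nat \<Rightarrow> nat) \<Rightarrow> real"
  assume x: "\<forall>I\<in>P. (\<Sum>j\<in>multi_indices n I. (x I j)\<^sup>2) \<le> 1"
  have sub: "I \<subseteq> {1..d}" if "I \<in> P" for I
    using assms that by (auto simp: partition_on_def)
  have fin: "finite (multi_indices n I)" if "I \<in> P" for I
    using finite_subset[OF sub[OF that]] by (auto simp: multi_indices_def intro!: finite_PiE)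
  have le1: "\<bar>x I (restrict i I)\<bar> \<le> 1" if I: "I \<in> P" and i: "i \<in> multi_indices n {1..d}" for I i
  proof -
    have "restrict i I \<in> multi_indices n I"
      using i sub[OF I] unfolding multi_indices_def by (auto simp: PiE_iff)
    then have "(x I (restrict i I))\<^sup>2 \<le> (\<Sum>j\<in>multi_indices n I. (x I j)\<^sup>2)"
      using fin[OF I] by (intro member_le_sum[where f = "\<lambda>j. (x I j)\<^sup>2"]) simp_all
    then show ?thesis
      using x I by (force simp: abs_square_le_1[symmetric])
  qed
  have "A i * (\<Prod>I\<in>P. x I (restrict i I)) \<le> \<bar>A i\<bar>" if i: "i \<in> multi_indices n {1..d}" for i
  proof -
    have "\<bar>\<Prod>I\<in>P. x I (restrict i I)\<bar> \<le> 1"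
      unfolding abs_prod using le1 i by (intro prod_le_1) auto
    then have "\<bar>A i * (\<Prod>I\<in>P. x I (restrict i I))\<bar> \<le> \<bar>A i\<bar>"
      by (simp add: abs_mult mult_left_le)
    then show ?thesis by linarith
  qed
  then show "(\<Sum>i\<in>multi_indices n {1..d}. A i * (\<Prod>I\<in>P. x I (restrict i I)))
      \<le> (\<Sum>i\<in>multi_indices n {1..d}. \<bar>A i\<bar>)"
    by (rule sum_mono)
qed

text \<open>Expectations of functions of independent standard Gaussians depend only on their number, not
  on the underlying probability space.\<close>

lemma expectation_std_gaussians:
  fixes M :: "'a measure" and f :: "(nat \<Rightarrow> real) \<Rightarrow> real"
  assumes "prob_space M"
    and "n \<ge> 1"
    and indep: "prob_space.indep_vars M (\<lambda>_. borel) g {1..n}"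
    and normal: "\<And>j. j \<in> {1..n} \<Longrightarrow> distributed M lborel (g j) std_normal_density"
    and f: "f \<in> borel_measurable (PiM {1..n} (\<lambda>_. borel))"
  shows "prob_space.expectation M (\<lambda>\<omega>. f (\<lambda>j\<in>{1..n}. g j \<omega>)) =
    integral\<^sup>L (PiM {1..n} (\<lambda>_. density lborel std_normal_density)) f"
proof -
  interpret prob_space M by fact
  have rv: "random_variable borel (g j)" if "j \<in> {1..n}" for j
    using distributed_measurable[OF normal[OF that]] by simp
  have law: "distr M borel (g j) = density lborel std_normal_density" if "j \<in> {1..n}" for j
    using distributed_distr_eq_density[OF normal[OF that]]
    by (metis distr_cong sets_lborel)
  have "distr M (PiM {1..n} (\<lambda>_. borel)) (\<lambda>\<omega>. \<lambda>j\<in>{1..n}. g j \<omega>) =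
      PiM {1..n} (\<lambda>j. distr M borel (g j))"
    using indep_vars_iff_distr_eq_PiM'[where I = "{1..n}" and X = g and M' = "\<lambda>_. borel"] rv indep
      \<open>n \<ge> 1\<close> by simp
  also have "\<dots> = PiM {1..n} (\<lambda>_. density lborel std_normal_density)"
    by (rule PiM_cong) (auto simp: law)
  finally have *: "distr M (PiM {1..n} (\<lambda>_. borel)) (\<lambda>\<omega>. \<lambda>j\<in>{1..n}. g j \<omega>) =
      PiM {1..n} (\<lambda>_. density lborel std_normal_density)" .
  have "(\<lambda>\<omega>. \<lambda>j\<in>{1..n}. g j \<omega>) \<in> M \<rightarrow>\<^sub>M PiM {1..n} (\<lambda>_. borel)"
    using rv by (intro measurable_restrict) auto
  then show ?thesis
    unfolding *[symmetric] by (rule integral_distr[OF _ f, symmetric])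
qed

end

theory Submission
  imports Defs
begin

text \<open>
  The supremum is controlled by a variational (PAC-Bayes) argument instead of chaining. Write
  \<open>F(\<theta>, y) = \<Sum>\<^sub>j y\<^sub>j u\<^sub>j(\<theta>)\<close>, where the \<open>u\<^sub>j\<close> are multilinear in \<open>\<theta> = (\<theta>\<^sup>1, \<dots>, \<theta>\<^bsup>d-1\<^esup>)\<close>. Let
  \<open>\<gamma>\<close> be the standard Gaussian law of \<open>\<theta>\<close> and \<open>w\<close> the density with respect to \<open>\<gamma>\<close> of its
  translate by \<open>a = \<surd>p x\<close>. For \<open>h(\<theta>) = \<Sum>\<^sub>j (\<kappa> y\<^sub>j u\<^sub>j - \<kappa>\<^sup>2 u\<^sub>j\<^sup>2 / 2)\<close>, integrating
  \<open>e\<^sup>h \<ge> w (1 + h - ln w)\<close> gives \<open>\<integral> w h d\<gamma> - |a|\<^sup>2 / 2 \<le> Z(y) - 1\<close> with \<open>Z(y) = \<integral> e\<^sup>h d\<gamma>\<close>,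
  simultaneously for all \<open>x\<close>. By multilinearity \<open>\<integral> w F d\<gamma> = F(a, y)\<close>, while
  \<open>\<integral> w \<Sum>\<^sub>j u\<^sub>j\<^sup>2 d\<gamma>\<close> expands into a sum over \<open>S \<subseteq> {1, \<dots>, d - 1}\<close> of terms bounded by
  \<open>p\<^bsup>d-1-|S|\<^esup>\<close> times the squared norm of \<open>A\<close> for the partition whose blocks are \<open>S \<union> {d}\<close> and
  singletons. Finally \<open>E Z(g) = 1\<close> by Fubini, and one optimises over \<open>\<kappa>\<close>.
\<close>

section \<open>Moments of Gaussian measures and their translates\<close>

definition std_gaussian :: "'q set \<Rightarrow> ('q \<Rightarrow> real) measure" where
  "std_gaussian Q = PiM Q (\<lambda>_. std_normal_distribution)"

text \<open>The \<open>c\<close>-th moment of a unit-variance Gaussian with mean \<open>a\<close>, correct for \<open>c \<le> 2\<close> only.\<close>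

definition shift_moment :: "real \<Rightarrow> nat \<Rightarrow> real" where
  "shift_moment a c = (if c = 0 then 1 else if c = 1 then a else a\<^sup>2 + 1)"

text \<open>Expanding \<open>u ^ c\<close> about the mean \<open>a\<close> reduces everything to the
  central moments of orders 0, 1, 2, which are 1, 0, 1.\<close>

lemma has_bochner_integral_normal_moment:
  assumes "c \<le> 2"
  shows "has_bochner_integral lborel (\<lambda>u. normal_density a 1 u * u ^ c) (shift_moment a c)"
proof -
  have 0: "has_bochner_integral lborel (normal_density a 1) 1"
    by (simp add: has_bochner_integral_iff integral_normal_density)
  have 1: "has_bochner_integral lborel (\<lambda>u. normal_density a 1 u * (u - a)) 0"
    using normal_moment_odd[of 1 a 0] by simp
  have 2: "has_bochner_integral lborel (\<lambda>u. normal_density a 1 u * (u - a)\<^sup>2) 1"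
    using normal_moment_even[of 1 a 1] by simp
  from assms consider "c = 0" | "c = 1" | "c = 2" by linarith
  then show ?thesis
  proof cases
    case 1 then show ?thesis using 0 by (simp add: shift_moment_def)
  next
    case 2
    have "has_bochner_integral lborel (\<lambda>u. normal_density a 1 u * (u - a) + a * normal_density a 1 u) (0 + a * 1)"
      using 0 1 by (intro has_bochner_integral_add has_bochner_integral_mult_right) auto
    then show ?thesis using 2 by (simp add: shift_moment_def algebra_simps)
  next
    case 3
    have "has_bochner_integral lborel (\<lambda>u. normal_density a 1 u * (u - a)\<^sup>2
        + (2 * a * (normal_density a 1 u * (u - a)) + a\<^sup>2 * normal_density a 1 u)) (1 + (2 * a * 0 + a\<^sup>2 * 1))"
      using 0 1 2 by (intro has_bochner_integral_add has_bochner_integral_mult_right) auto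
    then show ?thesis using 3 by (simp add: shift_moment_def algebra_simps power2_eq_square)
  qed
qed

text \<open>Completing the square makes the exponential factor the density of the translate with
  respect to the standard Gaussian.\<close>

lemma normal_density_eq_tilted:
  "normal_density a 1 u = std_normal_density u * exp (a * u - a\<^sup>2 / 2)"
  by (simp add: normal_density_def exp_add[symmetric] field_simps power2_eq_square)

lemma has_bochner_integral_tilted_moment:
  assumes "c \<le> 2"
  shows "has_bochner_integral std_normal_distribution
    (\<lambda>u. exp (a * u - a\<^sup>2 / 2) * u ^ c) (shift_moment a c)"
  using has_bochner_integral_normal_moment[OF assms, of a]
  by (intro has_bochner_integral_density) (auto simp: normal_density_eq_tilted[of a] mult.assoc)

lemma prob_space_std_gaussian: "prob_space (std_gaussian Q)"
  unfolding std_gaussian_def by (intro prob_space_PiM prob_space_normal_density) simp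

lemma measurable_std_gaussian_component:
  "q \<in> Q \<Longrightarrow> (\<lambda>\<theta>. \<theta> q) \<in> borel_measurable (std_gaussian Q)"
  unfolding std_gaussian_def by measurable

text \<open>The Cameron--Martin density of the translate by \<open>a\<close>.\<close>

definition tilt :: "'q set \<Rightarrow> ('q \<Rightarrow> real) \<Rightarrow> ('q \<Rightarrow> real) \<Rightarrow> real" where
  "tilt Q a \<theta> = (\<Prod>q\<in>Q. exp (a q * \<theta> q - (a q)\<^sup>2 / 2))"

lemma tilt_eq_exp: "finite Q \<Longrightarrow> tilt Q a \<theta> = exp (\<Sum>q\<in>Q. a q * \<theta> q - (a q)\<^sup>2 / 2)"
  by (simp add: tilt_def exp_sum)

text \<open>The tilt and the monomial are both products over coordinates, so the integral
  factorises. Exponents up to 2 suffice: a product of two multilinear monomials contains each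
  coordinate at most twice.\<close>

lemma has_bochner_integral_tilt_monomial:
  assumes "finite Q" and "\<And>q. q \<in> Q \<Longrightarrow> c q \<le> 2"
  shows "has_bochner_integral (std_gaussian Q) (\<lambda>\<theta>. tilt Q a \<theta> * (\<Prod>q\<in>Q. \<theta> q ^ c q))
    (\<Prod>q\<in>Q. shift_moment (a q) (c q))"
proof -
  let ?N = std_normal_distribution
  interpret N: prob_space ?N by (rule prob_space_normal_density) simp
  interpret product_sigma_finite "\<lambda>_. ?N" ..
  have *: "has_bochner_integral ?N (\<lambda>u. exp (a q * u - (a q)\<^sup>2 / 2) * u ^ c q) (shift_moment (a q) (c q))"
    if "q \<in> Q" for q
    using assms that by (intro has_bochner_integral_tilted_moment) auto
  show ?thesis
    unfolding std_gaussian_def tilt_def prod.distrib[symmetric] has_bochner_integral_iff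
    using * assms(1) product_integrable_prod[of Q "\<lambda>q u. exp (a q * u - (a q)\<^sup>2 / 2) * u ^ c q"]
      product_integral_prod[of Q "\<lambda>q u. exp (a q * u - (a q)\<^sup>2 / 2) * u ^ c q"]
    by (auto simp: has_bochner_integral_iff)
qed

lemma has_bochner_integral_tilt:
  "finite Q \<Longrightarrow> has_bochner_integral (std_gaussian Q) (tilt Q a) 1"
  using has_bochner_integral_tilt_monomial[of Q "\<lambda>_. 0" a] by (simp add: shift_moment_def)

text \<open>The value is the relative entropy of the translate with respect to
  \<open>std_gaussian Q\<close>: under the translate \<open>\<theta> q\<close> has mean
  \<open>a q\<close>. It is the cost term of the variational bound.\<close>

lemma has_bochner_integral_tilt_ln:
  assumes "finite Q"
  shows "has_bochner_integral (std_gaussian Q)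
    (\<lambda>\<theta>. tilt Q a \<theta> * (\<Sum>q\<in>Q. a q * \<theta> q - (a q)\<^sup>2 / 2)) (\<Sum>q\<in>Q. (a q)\<^sup>2 / 2)"
proof -
  have "has_bochner_integral (std_gaussian Q) (\<lambda>\<theta>. tilt Q a \<theta> * \<theta> q) (a q)" if "q \<in> Q" for q
  proof -
    have "(\<Prod>r\<in>Q. shift_moment (a r) (of_bool (r = q))) = (\<Prod>r\<in>Q. if r = q then a r else 1)"
      by (intro prod.cong) (auto simp: shift_moment_def)
    moreover have "(\<Prod>r\<in>Q. \<theta> r ^ of_bool (r = q)) = \<theta> q" for \<theta> :: "'a \<Rightarrow> real"
    proof -
      have "(\<Prod>r\<in>Q. \<theta> r ^ of_bool (r = q)) = (\<Prod>r\<in>Q. if r = q then \<theta> r else 1)"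
        by (intro prod.cong) auto
      then show ?thesis using assms that by simp
    qed
    ultimately show ?thesis
      using has_bochner_integral_tilt_monomial[of Q "\<lambda>r. of_bool (r = q)" a] assms that by simp
  qed
  then have "has_bochner_integral (std_gaussian Q)
      (\<lambda>\<theta>. \<Sum>q\<in>Q. a q * (tilt Q a \<theta> * \<theta> q) - (a q)\<^sup>2 / 2 * tilt Q a \<theta>)
      (\<Sum>q\<in>Q. a q * a q - (a q)\<^sup>2 / 2 * 1)"
    using has_bochner_integral_tilt[OF assms, of a]
    by (intro has_bochner_integral_sum has_bochner_integral_diff has_bochner_integral_mult_right) auto
  then show ?thesis
    by (simp add: sum_distrib_left algebra_simps power2_eq_square)
qed

section \<open>Multilinear forms under the tilt, and the variational bound\<close>

text \<open>Exponents 0 and 1 write the multilinear monomial with indices \<open>i\<close> as a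
  monomial over the whole grid \<open>L \<times> K\<close>, the form that
  \<open>has_bochner_integral_tilt_monomial\<close> handles.\<close>

lemma prod_power_of_bool:
  fixes f :: "'l \<times> 'k \<Rightarrow> real"
  assumes "finite K" "\<And>l. l \<in> L \<Longrightarrow> i l \<in> K"
  shows "(\<Prod>q\<in>L \<times> K. f q ^ of_bool (i (fst q) = snd q)) = (\<Prod>l\<in>L. f (l, i l))"
proof -
  have "(\<Prod>k\<in>K. f (l, k) ^ of_bool (i l = k)) = f (l, i l)" if "l \<in> L" for l
  proof -
    have "(\<Prod>k\<in>K. f (l, k) ^ of_bool (i l = k)) = (\<Prod>k\<in>K. if k = i l then f (l, k) else 1)"
      by (intro prod.cong) auto
    then show ?thesis using assms that by simp
  qed
  then have "(\<Prod>l\<in>L. \<Prod>k\<in>K. f (l, k) ^ of_bool (i l = k)) = (\<Prod>l\<in>L. f (l, i l))"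
    by (intro prod.cong) auto
  then show ?thesis
    by (simp add: prod.cartesian_product case_prod_beta)
qed

text \<open>In row \<open>l\<close>, coinciding indices give one second moment and distinct ones a
  product of two means; both cases are the product of the means plus a Kronecker delta.\<close>

lemma prod_shift_moment:
  assumes "finite K" "\<And>l. l \<in> L \<Longrightarrow> i l \<in> K" "\<And>l. l \<in> L \<Longrightarrow> i' l \<in> K"
  shows "(\<Prod>q\<in>L \<times> K. shift_moment (a q) (of_bool (i (fst q) = snd q) + of_bool (i' (fst q) = snd q)))
    = (\<Prod>l\<in>L. of_bool (i l = i' l) + a (l, i l) * a (l, i' l))"
proof -
  have "(\<Prod>k\<in>K. shift_moment (a (l, k)) (of_bool (i l = k) + of_bool (i' l = k)))
      = of_bool (i l = i' l) + a (l, i l) * a (l, i' l)" if "l \<in> L" for l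
  proof (cases "i l = i' l")
    case True
    have "(\<Prod>k\<in>K. shift_moment (a (l, k)) (of_bool (i l = k) + of_bool (i' l = k)))
        = (\<Prod>k\<in>K. if k = i l then (a (l, k))\<^sup>2 + 1 else 1)"
      using True by (intro prod.cong) (auto simp: shift_moment_def)
    then show ?thesis using assms that True by (simp add: power2_eq_square)
  next
    case False
    have "(\<Prod>k\<in>K. shift_moment (a (l, k)) (of_bool (i l = k) + of_bool (i' l = k)))
        = (\<Prod>k\<in>K. (if k = i l then a (l, k) else 1) * (if k = i' l then a (l, k) else 1))"
      using False by (intro prod.cong) (auto simp: shift_moment_def)
    then show ?thesis using assms that False by (simp add: prod.distrib)
  qed
  then have "(\<Prod>l\<in>L. \<Prod>k\<in>K. shift_moment (a (l, k)) (of_bool (i l = k) + of_bool (i' l = k)))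
      = (\<Prod>l\<in>L. of_bool (i l = i' l) + a (l, i l) * a (l, i' l))"
    by (intro prod.cong) auto
  then show ?thesis
    by (simp add: prod.cartesian_product case_prod_beta)
qed

text \<open>The factors sit in distinct rows, hence are independent under the translate and each is
  replaced by its mean. So a multilinear form averages to its value at \<open>a\<close>.\<close>

lemma has_bochner_integral_tilt_multilinear:
  fixes L :: "'l set" and K :: "'k set"
  assumes "finite L" "finite K" "\<And>l. l \<in> L \<Longrightarrow> i l \<in> K"
  shows "has_bochner_integral (std_gaussian (L \<times> K))
    (\<lambda>\<theta>. tilt (L \<times> K) a \<theta> * (\<Prod>l\<in>L. \<theta> (l, i l))) (\<Prod>l\<in>L. a (l, i l))"
proof -
  have "(\<Prod>q\<in>L \<times> K. shift_moment (a q) (of_bool (i (fst q) = snd q)))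
      = (\<Prod>q\<in>L \<times> K. a q ^ of_bool (i (fst q) = snd q))"
    by (intro prod.cong) (auto simp: shift_moment_def)
  then show ?thesis
    using has_bochner_integral_tilt_monomial[of "L \<times> K" "\<lambda>q. of_bool (i (fst q) = snd q)" a] assms
    by (simp add: prod_power_of_bool)
qed

lemma has_bochner_integral_tilt_multilinear_product:
  fixes L :: "'l set" and K :: "'k set"
  assumes "finite L" "finite K" "\<And>l. l \<in> L \<Longrightarrow> i l \<in> K" "\<And>l. l \<in> L \<Longrightarrow> i' l \<in> K"
  shows "has_bochner_integral (std_gaussian (L \<times> K))
    (\<lambda>\<theta>. tilt (L \<times> K) a \<theta> * ((\<Prod>l\<in>L. \<theta> (l, i l)) * (\<Prod>l\<in>L. \<theta> (l, i' l))))
    (\<Prod>l\<in>L. of_bool (i l = i' l) + a (l, i l) * a (l, i' l))"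
  using has_bochner_integral_tilt_monomial[of "L \<times> K"
      "\<lambda>q. of_bool (i (fst q) = snd q) + of_bool (i' (fst q) = snd q)" a] assms
  by (simp add: prod_power_of_bool prod_shift_moment power_add prod.distrib)

text \<open>A linearised Gibbs variational principle: \<open>ln Z\<close> is replaced by the larger \<open>Z - 1\<close>.\<close>

lemma tilt_variational:
  assumes "finite Q"
    and h: "has_bochner_integral (std_gaussian Q) (\<lambda>\<theta>. tilt Q a \<theta> * h \<theta>) H"
    and Z: "integrable (std_gaussian Q) (\<lambda>\<theta>. exp (h \<theta>))"
  shows "H - (\<Sum>q\<in>Q. (a q)\<^sup>2 / 2) \<le> (\<integral>\<theta>. exp (h \<theta>) \<partial>std_gaussian Q) - 1"
proof -
  let ?s = "\<lambda>\<theta>. \<Sum>q\<in>Q. a q * \<theta> q - (a q)\<^sup>2 / 2"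
  have int: "has_bochner_integral (std_gaussian Q)
      (\<lambda>\<theta>. tilt Q a \<theta> + tilt Q a \<theta> * h \<theta> - tilt Q a \<theta> * ?s \<theta>) (1 + H - (\<Sum>q\<in>Q. (a q)\<^sup>2 / 2))"
    by (intro has_bochner_integral_diff has_bochner_integral_add has_bochner_integral_tilt
        has_bochner_integral_tilt_ln h assms(1))
  have "tilt Q a \<theta> + tilt Q a \<theta> * h \<theta> - tilt Q a \<theta> * ?s \<theta> \<le> exp (h \<theta>)" for \<theta>
  proof -
    \<comment> \<open>Here \<open>?s\<close> is the logarithm of the tilt; the inequality
      \<open>1 + t \<le> exp t\<close> is taken at
      \<open>t = h \<theta> - ?s \<theta>\<close>.\<close>
    have "exp (?s \<theta>) * (1 + (h \<theta> - ?s \<theta>)) \<le> exp (?s \<theta>) * exp (h \<theta> - ?s \<theta>)"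
      by (intro mult_left_mono exp_ge_add_one_self) simp
    then show ?thesis
      by (simp add: tilt_eq_exp[OF assms(1)] exp_add[symmetric] algebra_simps)
  qed
  then have "1 + H - (\<Sum>q\<in>Q. (a q)\<^sup>2 / 2) \<le> (\<integral>\<theta>. exp (h \<theta>) \<partial>std_gaussian Q)"
    using int Z by (subst has_bochner_integral_integral_eq[OF int, symmetric], intro integral_mono)
      (auto simp: has_bochner_integral_iff)
  then show ?thesis by simp
qed

section \<open>Averages of exponentials of Gaussian sums\<close>

text \<open>Each factor turns the standard normal density into the one with mean \<open>v j\<close>,
  of total mass 1; independence multiplies the factors.\<close>

lemma nn_integral_exp_gaussian:
  assumes "prob_space M" "finite J"
    and indep: "prob_space.indep_vars M (\<lambda>_. borel) g J"
    and normal: "\<And>j. j \<in> J \<Longrightarrow> distributed M lborel (g j) std_normal_density"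
  shows "(\<integral>\<^sup>+\<omega>. ennreal (exp (\<Sum>j\<in>J. v j * g j \<omega> - (v j)\<^sup>2 / 2)) \<partial>M) = 1"
proof -
  interpret prob_space M by fact
  have one: "(\<integral>\<^sup>+\<omega>. ennreal (exp (v j * g j \<omega> - (v j)\<^sup>2 / 2)) \<partial>M) = 1" if "j \<in> J" for j
  proof -
    have "(\<integral>\<^sup>+\<omega>. ennreal (exp (v j * g j \<omega> - (v j)\<^sup>2 / 2)) \<partial>M)
        = (\<integral>\<^sup>+u. ennreal (std_normal_density u) * ennreal (exp (v j * u - (v j)\<^sup>2 / 2)) \<partial>lborel)"
      by (rule distributed_nn_integral[OF normal[OF that], symmetric]) simp
    also have "\<dots> = (\<integral>\<^sup>+u. ennreal (normal_density (v j) 1 u) \<partial>lborel)"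
      by (simp add: normal_density_eq_tilted[of "v j"] ennreal_mult)
    also have "\<dots> = 1"
      by (simp add: nn_integral_eq_integral integral_normal_density)
    finally show ?thesis .
  qed
  have "(\<integral>\<^sup>+\<omega>. ennreal (exp (\<Sum>j\<in>J. v j * g j \<omega> - (v j)\<^sup>2 / 2)) \<partial>M)
      = (\<integral>\<^sup>+\<omega>. (\<Prod>j\<in>J. ennreal (exp (v j * g j \<omega> - (v j)\<^sup>2 / 2))) \<partial>M)"
    using assms(2) by (simp add: exp_sum prod_ennreal)
  also have "\<dots> = (\<Prod>j\<in>J. \<integral>\<^sup>+\<omega>. ennreal (exp (v j * g j \<omega> - (v j)\<^sup>2 / 2)) \<partial>M)"
    by (rule indep_vars_nn_integral[OF assms(2)])
      (auto intro!: indep_vars_compose2[OF indep, where Y = "\<lambda>j u. ennreal (exp (v j * u - (v j)\<^sup>2 / 2))" and N = "\<lambda>_. borel"])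
  finally show ?thesis by (simp add: one)
qed

text \<open>Completing the square bounds each summand by \<open>(y j)^2 / 2\<close> uniformly in
  \<open>\<theta>\<close>. The subtracted squares thus give integrability without any bound on
  \<open>v\<close>.\<close>

lemma integrable_exp_linear_minus_square:
  fixes v :: "'j \<Rightarrow> 'b \<Rightarrow> real"
  assumes "prob_space N" and v [measurable]: "\<And>j. j \<in> J \<Longrightarrow> v j \<in> borel_measurable N"
  shows "integrable N (\<lambda>\<theta>. exp (\<Sum>j\<in>J. v j \<theta> * y j - (v j \<theta>)\<^sup>2 / 2))"
proof -
  interpret N: prob_space N by fact
  show ?thesis
  proof (rule N.integrable_const_bound)
    have "v j \<theta> * y j - (v j \<theta>)\<^sup>2 / 2 \<le> (y j)\<^sup>2 / 2" for j \<theta>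
      using zero_le_power2[of "v j \<theta> - y j"] by (simp add: power2_diff mult.commute)
    then show "AE \<theta> in N. norm (exp (\<Sum>j\<in>J. v j \<theta> * y j - (v j \<theta>)\<^sup>2 / 2))
        \<le> exp (\<Sum>j\<in>J. (y j)\<^sup>2 / 2)"
      by (auto intro!: sum_mono)
  qed simp
qed

text \<open>By Fubini for nonnegative functions the expectation over \<open>M\<close> can be taken
  first; it is 1 for every \<open>\<theta>\<close>, and \<open>N\<close> has mass 1.\<close>

lemma has_bochner_integral_exp_gaussian_mixture:
  fixes v :: "'j \<Rightarrow> 'b \<Rightarrow> real"
  assumes "prob_space M" "prob_space N" "finite J"
    and indep: "prob_space.indep_vars M (\<lambda>_. borel) g J"
    and normal: "\<And>j. j \<in> J \<Longrightarrow> distributed M lborel (g j) std_normal_density"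
    and v [measurable]: "\<And>j. j \<in> J \<Longrightarrow> v j \<in> borel_measurable N"
  shows "has_bochner_integral M
    (\<lambda>\<omega>. \<integral>\<theta>. exp (\<Sum>j\<in>J. v j \<theta> * g j \<omega> - (v j \<theta>)\<^sup>2 / 2) \<partial>N) 1"
proof -
  interpret M: prob_space M by fact
  interpret N: prob_space N by fact
  interpret MN: pair_prob_space M N ..
  have [measurable]: "g j \<in> borel_measurable M" if "j \<in> J" for j
    using distributed_measurable[OF normal[OF that]] by simp
  define Z where "Z \<omega> = (\<integral>\<theta>. exp (\<Sum>j\<in>J. v j \<theta> * g j \<omega> - (v j \<theta>)\<^sup>2 / 2) \<partial>N)" for \<omega>
  have Z: "ennreal (Z \<omega>) = (\<integral>\<^sup>+\<theta>. ennreal (exp (\<Sum>j\<in>J. v j \<theta> * g j \<omega> - (v j \<theta>)\<^sup>2 / 2)) \<partial>N)" for \<omega>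
    unfolding Z_def using integrable_exp_linear_minus_square[OF assms(2) v]
    by (intro nn_integral_eq_integral[symmetric]) auto
  have [measurable]: "Z \<in> borel_measurable M"
    unfolding Z_def by measurable
  have "(\<integral>\<^sup>+\<omega>. ennreal (Z \<omega>) \<partial>M)
      = (\<integral>\<^sup>+\<theta>. (\<integral>\<^sup>+\<omega>. ennreal (exp (\<Sum>j\<in>J. v j \<theta> * g j \<omega> - (v j \<theta>)\<^sup>2 / 2)) \<partial>M) \<partial>N)"
    unfolding Z by (rule MN.Fubini'[symmetric]) measurable
  also have "\<dots> = (\<integral>\<^sup>+\<theta>. 1 \<partial>N)"
    using nn_integral_exp_gaussian[OF assms(1,3) indep normal, where v = "\<lambda>j. v j \<theta>" for \<theta>] by simp
  also have "\<dots> = ennreal 1"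
    by (simp add: N.emeasure_space_1)
  finally have "has_bochner_integral M Z 1"
    by (intro has_bochner_integral_nn_integral) (auto simp: Z_def)
  then show ?thesis unfolding Z_def .
qed

section \<open>Sums over multi-indices\<close>

text \<open>Expanding each square pairs indices of one fibre; the indicator lets both indices range
  over all of \<open>I\<close>.\<close>

lemma sum_square_fibres:
  fixes W :: "'i \<Rightarrow> real"
  assumes "finite I" "finite R" "r ` I \<subseteq> R"
  shows "(\<Sum>m\<in>R. (\<Sum>i\<in>{i \<in> I. r i = m}. W i)\<^sup>2)
    = (\<Sum>i\<in>I. \<Sum>i'\<in>I. of_bool (r i = r i') * (W i * W i'))"
proof -
  have "(\<Sum>i\<in>I. \<Sum>i'\<in>I. of_bool (r i = r i') * (W i * W i'))
      = (\<Sum>m\<in>R. \<Sum>i\<in>{i \<in> I. r i = m}. \<Sum>i'\<in>I. of_bool (r i = r i') * (W i * W i'))"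
    by (rule sum.group[OF assms, symmetric])
  also have "\<dots> = (\<Sum>m\<in>R. \<Sum>i\<in>{i \<in> I. r i = m}. \<Sum>i'\<in>{i \<in> I. r i = m}. W i * W i')"
  proof ((rule sum.cong[OF refl])+)
    fix m i assume "i \<in> {i \<in> I. r i = m}"
    then show "(\<Sum>i'\<in>I. of_bool (r i = r i') * (W i * W i')) = (\<Sum>i'\<in>{i \<in> I. r i = m}. W i * W i')"
      using assms(1) by (intro sum.mono_neutral_cong_right) auto
  qed
  finally show ?thesis
    by (simp add: power2_eq_square sum_product)
qed

lemma finite_multi_indices: "finite I \<Longrightarrow> finite (multi_indices n I)"
  by (auto simp: multi_indices_def intro!: finite_PiE)

lemma multi_indices_mem: "i \<in> multi_indices n I \<Longrightarrow> l \<in> I \<Longrightarrow> i l \<in> {1..n}"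
  unfolding multi_indices_def by (rule PiE_mem)

lemma restrict_multi_indices: "i \<in> multi_indices n I \<Longrightarrow> J \<subseteq> I \<Longrightarrow> restrict i J \<in> multi_indices n J"
  unfolding multi_indices_def by (auto simp: PiE_iff)

text \<open>Splits off one coordinate; for \<open>k = d\<close> this links sums of order
  \<open>d - 1\<close> contractions to sums over the full array.\<close>

lemma sum_multi_indices_insert:
  assumes "k \<notin> I"
  shows "(\<Sum>i\<in>multi_indices n I. \<Sum>j=1..n. f (i(k := j))) = (\<Sum>i\<in>multi_indices n (insert k I). f i)"
proof -
  have "(\<Sum>i\<in>multi_indices n (insert k I). f i)
      = (\<Sum>(j, i)\<in>{1..n} \<times> multi_indices n I. f (i(k := j)))"
    unfolding multi_indices_def PiE_insert_eq
    by (subst sum.reindex) (auto intro!: inj_combinator assms sum.cong)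
  also have "\<dots> = (\<Sum>j=1..n. \<Sum>i\<in>multi_indices n I. f (i(k := j)))"
    by (rule sum.cartesian_product[symmetric])
  finally show ?thesis by (subst sum.swap) simp
qed

lemma sum_multi_indices_singleton:
  "(\<Sum>i\<in>multi_indices n {l}. f (i l)) = (\<Sum>k=1..n. f k)"
  using sum_multi_indices_insert[of l "{}" "\<lambda>i. f (i l)" n] by (simp add: multi_indices_def)

section \<open>Partition norms and the moment functional\<close>

lemma partition_norm_upper:
  assumes "partition_on {1..d} P" "\<And>I. I \<in> P \<Longrightarrow> (\<Sum>j\<in>multi_indices n I. (x I j)\<^sup>2) \<le> 1"
  shows "(\<Sum>i\<in>multi_indices n {1..d}. A i * (\<Prod>I\<in>P. x I (restrict i I))) \<le> partition_norm n d P A"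
  unfolding partition_norm_def
  by (intro cSup_upper partition_norm_set_bdd_above assms(1)) (use assms(2) in blast)

lemma partition_norm_nonneg:
  assumes "partition_on {1..d} P" "d \<ge> 1"
  shows "partition_norm n d P A \<ge> 0"
proof -
  \<comment> \<open>An empty \<open>P\<close> would give an empty product, equal to 1; for nonempty
    \<open>P\<close> the zero arrays give the value 0.\<close>
  have "P \<noteq> {}" "finite P"
    using assms finite_elements[OF _ assms(1)] by (auto simp: partition_on_def)
  then show ?thesis
    using partition_norm_upper[OF assms(1), where x = "\<lambda>_ _. 0" and A = A and n = n]
    by (simp add: power_0_left)
qed

text \<open>One summand is at most the whole sum because all partition norms are nonnegative;
  \<open>card P\<close> lies in \<open>{1..d}\<close> since the blocks are nonempty and
  disjoint.\<close>

lemma partition_norm_le_moment: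
  assumes P: "partition_on {1..d} P" and "d \<ge> 1"
  shows "p powr (real (card P) / 2) * partition_norm n d P A \<le> moment n d p A"
proof -
  have fin: "finite (partitions k d)" for k
    by (rule finite_subset[of _ "Pow (Pow {1..d})"]) (auto simp: partitions_def partition_on_def)
  have nn: "partition_norm n d Q A \<ge> 0" if "Q \<in> partitions k d" for Q k
    using that partition_norm_nonneg assms(2) by (auto simp: partitions_def)
  have "P \<noteq> {}" "finite P"
    using assms finite_elements[OF _ P] by (auto simp: partition_on_def)
  moreover have "card P \<le> d"
  proof -
    have "card P = (\<Sum>I\<in>P. 1)"
      by simp
    also have "\<dots> \<le> (\<Sum>I\<in>P. card I)"
      using P finite_subset[of _ "{1..d}"]
      by (intro sum_mono) (auto simp: partition_on_def Suc_le_eq card_gt_0_iff)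
    also have "\<dots> = card (\<Union>P)"
      using P by (intro card_Union_disjoint[symmetric])
        (auto simp: partition_on_def disjoint_def pairwise_def disjnt_def intro: finite_subset)
    finally show ?thesis using P by (simp add: partition_on_def)
  qed
  ultimately have k: "card P \<in> {1..d}"
    by (simp add: Suc_le_eq card_gt_0_iff)
  have "partition_norm n d P A \<le> (\<Sum>Q\<in>partitions (card P) d. partition_norm n d Q A)"
    using P by (intro member_le_sum nn fin) (auto simp: partitions_def)
  then have "p powr (real (card P) / 2) * partition_norm n d P A
      \<le> p powr (real (card P) / 2) * (\<Sum>Q\<in>partitions (card P) d. partition_norm n d Q A)"
    by (intro mult_left_mono) auto
  also have "\<dots> \<le> moment n d p A"
    unfolding moment_def using k
    by (intro member_le_sum[where f = "\<lambda>k. p powr (real k / 2) * (\<Sum>Q\<in>partitions k d. partition_norm n d Q A)"])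
      (auto intro!: sum_nonneg nn mult_nonneg_nonneg)
  finally show ?thesis .
qed

text \<open>\<open>S\<close> is the set of coordinates on which two copies of the index are forced
  to agree in the expanded second moment; they are fused with \<open>d\<close>.\<close>

definition last_block_partition :: "nat \<Rightarrow> nat set \<Rightarrow> nat set set" where
  "last_block_partition d S = insert (insert d S) ((\<lambda>l. {l}) ` ({1..<d} - S))"

lemma partition_on_last_block_partition:
  assumes "d \<ge> 1" "S \<subseteq> {1..<d}"
  shows "partition_on {1..d} (last_block_partition d S)"
  using assms unfolding partition_on_def disjoint_def last_block_partition_def
  by (auto simp: subset_iff)

lemma prod_last_block_partition:
  fixes S :: "nat set" and f :: "nat set \<Rightarrow> real"
  shows "prod f (last_block_partition d S) = f (insert d S) * (\<Prod>l\<in>{1..<d} - S. f {l})"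
proof -
  have "insert d S \<notin> (\<lambda>l. {l}) ` ({1..<d} - S)" by auto
  then show ?thesis
    unfolding last_block_partition_def by (simp add: prod.reindex)
qed

lemma card_last_block_partition:
  "card (last_block_partition d S) = Suc (card ({1..<d} - S))"
proof -
  have "insert d S \<notin> (\<lambda>l. {l}) ` ({1..<d} - S)" by auto
  then show ?thesis
    unfolding last_block_partition_def by (simp add: card_image)
qed

text \<open>Euclidean duality: with the vectors outside \<open>S\<close> fixed, the 2-norm of the
  contracted array is attained by testing it against its own normalisation, which is admissible in
  the block \<open>insert d S\<close>.\<close>

lemma contraction_square_le_partition_norm_square:
  assumes "d \<ge> 1" and S: "S \<subseteq> {1..<d}"
    and x: "\<And>l. l \<in> {1..<d} \<Longrightarrow> (\<Sum>k=1..n. (x l k)\<^sup>2) \<le> 1"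
  shows "(\<Sum>m\<in>multi_indices n (insert d S).
      (\<Sum>i\<in>{i \<in> multi_indices n {1..d}. restrict i (insert d S) = m}. A i * (\<Prod>l\<in>{1..<d} - S. x l (i l)))\<^sup>2)
    \<le> (partition_norm n d (last_block_partition d S) A)\<^sup>2"
proof -
  let ?T = "insert d S" and ?N = "partition_norm n d (last_block_partition d S) A"
  define W where "W i = A i * (\<Prod>l\<in>{1..<d} - S. x l (i l))" for i
  define b where "b m = (\<Sum>i\<in>{i \<in> multi_indices n {1..d}. restrict i ?T = m}. W i)" for m
  define B where "B = sqrt (\<Sum>m\<in>multi_indices n ?T. (b m)\<^sup>2)"
  have B2: "B\<^sup>2 = (\<Sum>m\<in>multi_indices n ?T. (b m)\<^sup>2)"
    unfolding B_def by (simp add: sum_nonneg)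
  have T: "?T \<subseteq> {1..d}" using S assms(1) by auto
  have finT: "finite ?T" using S finite_subset by auto
  have "B\<^sup>2 \<le> ?N\<^sup>2"
  \<comment> \<open>The normalisation divides by \<open>B\<close>; for \<open>B = 0\<close> the
    claim is nonnegativity of a square.\<close>
  proof (cases "B = 0")
    case False
    then have "B > 0" unfolding B_def by (simp add: sum_nonneg less_le)
    \<comment> \<open>the normalised array \<open>b\<close> is the maximiser in the block \<open>S \<union> {d}\<close>\<close>
    define X where "X I = (if I = ?T then (\<lambda>m. b m / B) else (\<lambda>m. x (the_elem I) (m (the_elem I))))" for I :: "nat set"
    have neq: "{l} \<noteq> ?T" if "l \<in> {1..<d} - S" for l using that by auto
    have "(\<Sum>i\<in>multi_indices n {1..d}. A i * (\<Prod>I\<in>last_block_partition d S. X I (restrict i I)))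
        = (\<Sum>i\<in>multi_indices n {1..d}. b (restrict i ?T) / B * W i)"
      unfolding prod_last_block_partition
      by (intro sum.cong refl) (simp add: W_def X_def neq)
    also have "\<dots> = (\<Sum>m\<in>multi_indices n ?T. \<Sum>i\<in>{i \<in> multi_indices n {1..d}. restrict i ?T = m}.
        b (restrict i ?T) / B * W i)"
      using T finT
      by (intro sum.group[symmetric] finite_multi_indices) (auto intro: restrict_multi_indices)
    also have "\<dots> = (\<Sum>m\<in>multi_indices n ?T. (b m)\<^sup>2 / B)"
    proof (intro sum.cong refl)
      fix m
      have "(\<Sum>i\<in>{i \<in> multi_indices n {1..d}. restrict i ?T = m}. b (restrict i ?T) / B * W i)
          = (\<Sum>i\<in>{i \<in> multi_indices n {1..d}. restrict i ?T = m}. b m / B * W i)"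
        by (intro sum.cong) auto
      also have "\<dots> = b m / B * b m"
        unfolding b_def by (rule sum_distrib_left[symmetric])
      finally show "(\<Sum>i\<in>{i \<in> multi_indices n {1..d}. restrict i ?T = m}. b (restrict i ?T) / B * W i) = (b m)\<^sup>2 / B"
        by (simp add: power2_eq_square)
    qed
    also have "\<dots> = B\<^sup>2 / B"
      unfolding B2 by (rule sum_divide_distrib[symmetric])
    also have "\<dots> = B"
      using \<open>B > 0\<close> by (simp add: power2_eq_square)
    finally have "(\<Sum>i\<in>multi_indices n {1..d}. A i * (\<Prod>I\<in>last_block_partition d S. X I (restrict i I))) = B" .
    moreover have "(\<Sum>j\<in>multi_indices n I. (X I j)\<^sup>2) \<le> 1" if I: "I \<in> last_block_partition d S" for I
    proof (cases "I = ?T")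
      case True
      then show ?thesis
        using \<open>B > 0\<close> by (simp add: X_def power_divide sum_divide_distrib[symmetric] B2[symmetric])
    next
      case False
      then obtain l where "l \<in> {1..<d} - S" "I = {l}"
        using I unfolding last_block_partition_def by blast
      then show ?thesis
        using False x[of l] sum_multi_indices_singleton[of "\<lambda>k. (x l k)\<^sup>2" l n] by (simp add: X_def)
    qed
    ultimately have "B \<le> ?N"
      using partition_norm_upper[OF partition_on_last_block_partition[OF assms(1) S], where x = X and A = A and n = n]
      by auto
    then show ?thesis using \<open>B > 0\<close> by (intro power_mono) auto
  qed simp
  then show ?thesis unfolding B2 by (simp add: b_def W_def)
qed

section \<open>Contraction of the last index\<close>

text \<open>Passes from arrays indexed by one-element multi-indices to ordinary vectors, and merges
  the contraction into one sum over multi-indices of order \<open>d\<close>.\<close>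

lemma partition_norm_contract_last_le:
  assumes "d \<ge> 1"
    and K: "\<And>x. (\<And>l. l \<in> {1..<d} \<Longrightarrow> (\<Sum>k=1..n. (x l k)\<^sup>2) \<le> 1) \<Longrightarrow>
      (\<Sum>i\<in>multi_indices n {1..d}. A i * y (i d) * (\<Prod>l\<in>{1..<d}. x l (i l))) \<le> K"
  shows "partition_norm n (d - 1) (singletons (d - 1)) (contract_last n d A y) \<le> K"
  unfolding partition_norm_def
proof (rule cSup_least[OF partition_norm_set_nonempty], clarify)
  fix X :: "nat set \<Rightarrow> (nat \<Rightarrow> nat) \<Rightarrow> real"
  assume X: "\<forall>I\<in>singletons (d - 1). (\<Sum>j\<in>multi_indices n I. (X I j)\<^sup>2) \<le> 1"
  have L: "{1..d - 1} = {1..<d}" "{1..d} = insert d {1..<d}" using assms(1) by auto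
  \<comment> \<open>The function \<open>restrict (\<lambda>_. k) {l}\<close> is the one-element
    multi-index on \<open>{l}\<close> with value \<open>k\<close>.\<close>
  define x where "x l k = X {l} (restrict (\<lambda>_. k) {l})" for l k
  have x: "X {l} (restrict i {l}) = x l (i l)" for l i
    unfolding x_def by (rule arg_cong[where f = "X {l}"]) auto
  have "(\<Sum>k=1..n. (x l k)\<^sup>2) \<le> 1" if "l \<in> {1..<d}" for l
  proof -
    have "(\<Sum>k=1..n. (x l k)\<^sup>2) = (\<Sum>i\<in>multi_indices n {l}. (X {l} (restrict i {l}))\<^sup>2)"
      using sum_multi_indices_singleton[of "\<lambda>k. (x l k)\<^sup>2" l n] by (simp add: x)
    also have "\<dots> = (\<Sum>i\<in>multi_indices n {l}. (X {l} i)\<^sup>2)"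
      by (intro sum.cong refl) (simp add: multi_indices_def PiE_restrict)
    finally show ?thesis using X that by (auto simp: singletons_def L)
  qed
  then have "(\<Sum>i\<in>multi_indices n {1..d}. A i * y (i d) * (\<Prod>l\<in>{1..<d}. x l (i l))) \<le> K"
    by (rule K)
  moreover have "(\<Sum>i\<in>multi_indices n {1..d - 1}. contract_last n d A y i * (\<Prod>I\<in>singletons (d - 1). X I (restrict i I)))
      = (\<Sum>i\<in>multi_indices n {1..d}. A i * y (i d) * (\<Prod>l\<in>{1..<d}. x l (i l)))"
    unfolding singletons_def L
    by (simp add: sum_multi_indices_insert[symmetric] prod.reindex contract_last_def sum_distrib_right x)
  ultimately show "(\<Sum>i\<in>multi_indices n {1..d - 1}. contract_last n d A y i * (\<Prod>I\<in>singletons (d - 1). X I (restrict i I))) \<le> K"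
    by simp
qed

section \<open>The multilinear process and its second moment\<close>

text \<open>Multiplying out the product over \<open>l\<close> selects the set \<open>S\<close> where
  the Kronecker delta is taken. With the delta at \<open>d\<close> this says that \<open>i\<close>
  and \<open>i'\<close> agree on \<open>insert d S\<close>; the other factors split into one for
  \<open>i\<close> and one for \<open>i'\<close>, so \<open>sum_square_fibres\<close>
  applies.\<close>

lemma sum_expected_square:
  fixes a :: "nat \<times> nat \<Rightarrow> real"
  assumes "d \<ge> 1"
  shows "(\<Sum>i\<in>multi_indices n {1..d}. \<Sum>i'\<in>multi_indices n {1..d}.
      of_bool (i d = i' d) * (A i * A i' * (\<Prod>l\<in>{1..<d}. of_bool (i l = i' l) + a (l, i l) * a (l, i' l))))
    = (\<Sum>S\<in>Pow {1..<d}. \<Sum>m\<in>multi_indices n (insert d S).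
      (\<Sum>i\<in>{i \<in> multi_indices n {1..d}. restrict i (insert d S) = m}. A i * (\<Prod>l\<in>{1..<d} - S. a (l, i l)))\<^sup>2)"
    (is "?lhs = _")
proof -
  let ?I = "multi_indices n {1..d}"
  have expand: "of_bool (i d = i' d) * (A i * A i' * (\<Prod>l\<in>{1..<d}. of_bool (i l = i' l) + a (l, i l) * a (l, i' l)))
      = (\<Sum>S\<in>Pow {1..<d}. of_bool (restrict i (insert d S) = restrict i' (insert d S)) *
          ((A i * (\<Prod>l\<in>{1..<d} - S. a (l, i l))) * (A i' * (\<Prod>l\<in>{1..<d} - S. a (l, i' l)))))"
    for i i' :: "nat \<Rightarrow> nat"
  proof -
    have "of_bool (restrict i (insert d S) = restrict i' (insert d S))
        = of_bool (i d = i' d) * (\<Prod>l\<in>S. of_bool (i l = i' l) :: real)" if "S \<in> Pow {1..<d}" for S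
    proof -
      have "finite S" using that finite_subset by auto
      then have "(\<Prod>l\<in>S. of_bool (i l = i' l) :: real) = of_bool (\<forall>l\<in>S. i l = i' l)"
        by (induction S) auto
      moreover have "restrict i (insert d S) = restrict i' (insert d S) \<longleftrightarrow> i d = i' d \<and> (\<forall>l\<in>S. i l = i' l)"
        by (auto simp: fun_eq_iff restrict_def)
      ultimately show ?thesis by auto
    qed
    then show ?thesis
      by (simp add: prod_add sum_distrib_left prod.distrib mult_ac)
  qed
  have "?lhs = (\<Sum>S\<in>Pow {1..<d}. \<Sum>i\<in>?I. \<Sum>i'\<in>?I. of_bool (restrict i (insert d S) = restrict i' (insert d S)) *
      ((A i * (\<Prod>l\<in>{1..<d} - S. a (l, i l))) * (A i' * (\<Prod>l\<in>{1..<d} - S. a (l, i' l)))))"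
    unfolding expand by (simp only: sum.swap[of _ "Pow {1..<d}"])
  also have "\<dots> = (\<Sum>S\<in>Pow {1..<d}. \<Sum>m\<in>multi_indices n (insert d S).
      (\<Sum>i\<in>{i \<in> ?I. restrict i (insert d S) = m}. A i * (\<Prod>l\<in>{1..<d} - S. a (l, i l)))\<^sup>2)"
  proof (rule sum.cong[OF refl], rule sum_square_fibres[symmetric])
    fix S assume S: "S \<in> Pow {1..<d}"
    then show "finite (multi_indices n (insert d S))"
      by (intro finite_multi_indices) (auto intro: finite_subset)
    have "insert d S \<subseteq> {1..d}" using S assms by auto
    then show "(\<lambda>i. restrict i (insert d S)) ` ?I \<subseteq> multi_indices n (insert d S)"
      using restrict_multi_indices by blast
  qed (simp add: finite_multi_indices)
  finally show ?thesis .
qed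

text \<open>This is \<open>\<kappa> u\<^sub>j(\<theta>)\<close> of the overview; the coordinate
  \<open>(l, k)\<close> of \<open>\<theta>\<close> is entry \<open>k\<close> of the
  \<open>l\<close>-th vector.\<close>

definition linear_process ::
    "nat \<Rightarrow> nat \<Rightarrow> ((nat \<Rightarrow> nat) \<Rightarrow> real) \<Rightarrow> real \<Rightarrow> nat \<Rightarrow> (nat \<times> nat \<Rightarrow> real) \<Rightarrow> real" where
  "linear_process n d A \<kappa> j \<theta> =
    \<kappa> * (\<Sum>i\<in>{i \<in> multi_indices n {1..d}. i d = j}. A i * (\<Prod>l\<in>{1..<d}. \<theta> (l, i l)))"

lemma borel_measurable_linear_process:
  "linear_process n d A \<kappa> j \<in> borel_measurable (std_gaussian ({1..<d} \<times> {1..n}))"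
proof -
  have "i l \<in> {1..n}" if "i \<in> multi_indices n {1..d}" "l \<in> {1..<d}" for i l
    using that by (intro multi_indices_mem[of i n "{1..d}"]) auto
  then show ?thesis
    unfolding linear_process_def[abs_def]
    by (intro borel_measurable_times borel_measurable_const borel_measurable_sum borel_measurable_prod
        measurable_std_gaussian_component) auto
qed

text \<open>Grouping multi-indices by their last entry writes the exponent as a combination of
  multilinear monomials and products of two of them, which can be integrated against the tilt term
  by term.\<close>

lemma linear_process_exponent:
  fixes \<theta> :: "nat \<times> nat \<Rightarrow> real"
  assumes "d \<ge> 1"
  shows "(\<Sum>j=1..n. linear_process n d A \<kappa> j \<theta> * y j - (linear_process n d A \<kappa> j \<theta>)\<^sup>2 / 2)
    = \<kappa> * (\<Sum>i\<in>multi_indices n {1..d}. A i * y (i d) * (\<Prod>l\<in>{1..<d}. \<theta> (l, i l)))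
      - \<kappa>\<^sup>2 / 2 * (\<Sum>i\<in>multi_indices n {1..d}. \<Sum>i'\<in>multi_indices n {1..d}. of_bool (i d = i' d) *
          (A i * A i' * ((\<Prod>l\<in>{1..<d}. \<theta> (l, i l)) * (\<Prod>l\<in>{1..<d}. \<theta> (l, i' l)))))"
proof -
  let ?I = "multi_indices n {1..d}"
  define W where "W i = A i * (\<Prod>l\<in>{1..<d}. \<theta> (l, i l))" for i
  have v: "linear_process n d A \<kappa> j \<theta> = \<kappa> * (\<Sum>i\<in>{i \<in> ?I. i d = j}. W i)" for j
    by (simp add: linear_process_def W_def)
  have fin: "finite ?I" and im: "(\<lambda>i. i d) ` ?I \<subseteq> {1..n}"
    using assms by (auto simp: finite_multi_indices dest: multi_indices_mem[where l = d])
  have "(\<Sum>j=1..n. linear_process n d A \<kappa> j \<theta> * y j) = \<kappa> * (\<Sum>j=1..n. \<Sum>i\<in>{i \<in> ?I. i d = j}. W i * y (i d))"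
    unfolding v by (auto simp: sum_distrib_left sum_distrib_right mult_ac intro!: sum.cong)
  also have "\<dots> = \<kappa> * (\<Sum>i\<in>?I. A i * y (i d) * (\<Prod>l\<in>{1..<d}. \<theta> (l, i l)))"
    using sum.group[OF fin _ im, of "\<lambda>i. W i * y (i d)"] by (simp add: W_def mult_ac)
  finally have 1: "(\<Sum>j=1..n. linear_process n d A \<kappa> j \<theta> * y j)
      = \<kappa> * (\<Sum>i\<in>?I. A i * y (i d) * (\<Prod>l\<in>{1..<d}. \<theta> (l, i l)))" .
  have "(\<Sum>j=1..n. (linear_process n d A \<kappa> j \<theta>)\<^sup>2 / 2) = \<kappa>\<^sup>2 / 2 * (\<Sum>j\<in>{1..n}. (\<Sum>i\<in>{i \<in> ?I. i d = j}. W i)\<^sup>2)"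
    unfolding v power_mult_distrib by (simp add: sum_distrib_left[symmetric] sum_divide_distrib[symmetric])
  also have "(\<Sum>j\<in>{1..n}. (\<Sum>i\<in>{i \<in> ?I. i d = j}. W i)\<^sup>2) = (\<Sum>i\<in>?I. \<Sum>i'\<in>?I. of_bool (i d = i' d) * (W i * W i'))"
    by (rule sum_square_fibres[OF fin _ im]) simp
  finally show ?thesis
    using 1 by (simp add: sum_subtractf W_def mult_ac)
qed

lemma has_bochner_integral_tilt_linear_process:
  fixes a :: "nat \<times> nat \<Rightarrow> real"
  assumes "d \<ge> 1"
  shows "has_bochner_integral (std_gaussian ({1..<d} \<times> {1..n}))
    (\<lambda>\<theta>. tilt ({1..<d} \<times> {1..n}) a \<theta> *
      (\<Sum>j=1..n. linear_process n d A \<kappa> j \<theta> * y j - (linear_process n d A \<kappa> j \<theta>)\<^sup>2 / 2))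
    (\<kappa> * (\<Sum>i\<in>multi_indices n {1..d}. A i * y (i d) * (\<Prod>l\<in>{1..<d}. a (l, i l)))
      - \<kappa>\<^sup>2 / 2 * (\<Sum>S\<in>Pow {1..<d}. \<Sum>m\<in>multi_indices n (insert d S).
      (\<Sum>i\<in>{i \<in> multi_indices n {1..d}. restrict i (insert d S) = m}. A i * (\<Prod>l\<in>{1..<d} - S. a (l, i l)))\<^sup>2))"
proof -
  let ?I = "multi_indices n {1..d}" and ?w = "tilt ({1..<d} \<times> {1..n}) a"
  let ?p = "\<lambda>\<theta> (i :: nat \<Rightarrow> nat). \<Prod>l\<in>{1..<d}. \<theta> (l, i l)"
  have mem: "i l \<in> {1..n}" if "i \<in> ?I" "l \<in> {1..<d}" for i l
    using that by (intro multi_indices_mem[of i n "{1..d}"]) auto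
  have "has_bochner_integral (std_gaussian ({1..<d} \<times> {1..n}))
      (\<lambda>\<theta>. \<kappa> * (\<Sum>i\<in>?I. A i * y (i d) * (?w \<theta> * ?p \<theta> i))
        - \<kappa>\<^sup>2 / 2 * (\<Sum>i\<in>?I. \<Sum>i'\<in>?I. of_bool (i d = i' d) * (A i * A i' * (?w \<theta> * (?p \<theta> i * ?p \<theta> i')))))
      (\<kappa> * (\<Sum>i\<in>?I. A i * y (i d) * ?p a i)
        - \<kappa>\<^sup>2 / 2 * (\<Sum>i\<in>?I. \<Sum>i'\<in>?I. of_bool (i d = i' d) *
          (A i * A i' * (\<Prod>l\<in>{1..<d}. of_bool (i l = i' l) + a (l, i l) * a (l, i' l)))))"
    by (intro has_bochner_integral_diff has_bochner_integral_mult_right has_bochner_integral_sum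
        has_bochner_integral_tilt_multilinear has_bochner_integral_tilt_multilinear_product mem) simp_all
  then show ?thesis
    unfolding sum_expected_square[OF assms] linear_process_exponent[OF assms]
    by (simp add: algebra_simps sum_distrib_left)
qed

section \<open>The bound for a fixed vector and its average\<close>

text \<open>The right side is free of the test vectors, so it bounds the supremum, and
  \<open>y\<close> enters it only through the integral. The last two terms bound the second moment
  and the entropy.\<close>

lemma partition_norm_contract_last_le_exp:
  assumes "d \<ge> 1" "p > 0" "\<kappa> > 0"
  shows "\<kappa> * sqrt p ^ (d - 1) * partition_norm n (d - 1) (singletons (d - 1)) (contract_last n d A y)
    \<le> (\<integral>\<theta>. exp (\<Sum>j=1..n. linear_process n d A \<kappa> j \<theta> * y j - (linear_process n d A \<kappa> j \<theta>)\<^sup>2 / 2)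
          \<partial>std_gaussian ({1..<d} \<times> {1..n})) - 1
      + (\<kappa>\<^sup>2 * 2 ^ (d - 1) * (moment n d p A)\<^sup>2 / (2 * p) + real (d - 1) * p / 2)"
proof -
  let ?I = "multi_indices n {1..d}" and ?Q = "{1..<d} \<times> {1..n}" and ?s = "sqrt p" and ?m = "moment n d p A"
  let ?v = "linear_process n d A \<kappa>"
  define Z where "Z = (\<integral>\<theta>. exp (\<Sum>j=1..n. ?v j \<theta> * y j - (?v j \<theta>)\<^sup>2 / 2) \<partial>std_gaussian ?Q)"
  define c where "c = \<kappa>\<^sup>2 * 2 ^ (d - 1) * ?m\<^sup>2 / (2 * p) + real (d - 1) * p / 2"
  have D: "\<kappa> * ?s ^ (d - 1) > 0" using assms by simp
  have "partition_norm n (d - 1) (singletons (d - 1)) (contract_last n d A y) \<le> (Z - 1 + c) / (\<kappa> * ?s ^ (d - 1))"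
  proof (rule partition_norm_contract_last_le[OF assms(1)])
    fix x :: "nat \<Rightarrow> nat \<Rightarrow> real"
    assume x: "\<And>l. l \<in> {1..<d} \<Longrightarrow> (\<Sum>k=1..n. (x l k)\<^sup>2) \<le> 1"
    \<comment> \<open>The scale \<open>sqrt p\<close> keeps the entropy below
      \<open>real (d - 1) * p / 2\<close> while enlarging the form by
      \<open>sqrt p ^ (d - 1)\<close>.\<close>
    define a where "a q = ?s * x (fst q) (snd q)" for q
    define V where "V S = (\<Sum>m\<in>multi_indices n (insert d S).
        (\<Sum>i\<in>{i \<in> ?I. restrict i (insert d S) = m}. A i * (\<Prod>l\<in>{1..<d} - S. a (l, i l)))\<^sup>2)" for S
    have V_le: "V S \<le> ?m\<^sup>2 / p" if S: "S \<subseteq> {1..<d}" for S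
    proof -
      let ?c = "card ({1..<d} - S)" and ?N = "partition_norm n d (last_block_partition d S) A"
      note P = partition_on_last_block_partition[OF assms(1) S]
      have "V S = (?s ^ ?c)\<^sup>2 * (\<Sum>m\<in>multi_indices n (insert d S).
        (\<Sum>i\<in>{i \<in> ?I. restrict i (insert d S) = m}. A i * (\<Prod>l\<in>{1..<d} - S. x l (i l)))\<^sup>2)"
        unfolding V_def a_def sum_distrib_left power_mult_distrib[symmetric]
        by (simp add: prod.distrib mult_ac)
      also have "\<dots> \<le> (?s ^ ?c)\<^sup>2 * ?N\<^sup>2"
        by (intro mult_left_mono contraction_square_le_partition_norm_square assms(1) S x) auto
      \<comment> \<open>The partition has \<open>Suc ?c\<close> blocks: the singletons and the one
        containing \<open>d\<close>. The power of \<open>sqrt p\<close> matching this count in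
        \<open>moment\<close> costs the division by \<open>p\<close>.\<close>
      also have "\<dots> = (?s ^ Suc ?c * ?N)\<^sup>2 / p"
        using assms(2) by (simp add: power_mult_distrib)
      also have "\<dots> \<le> ?m\<^sup>2 / p"
      proof -
        have "?s ^ Suc ?c = p powr (real (Suc ?c) / 2)"
          using assms(2) by (simp add: powr_half_sqrt[symmetric] powr_power del: power_Suc of_nat_Suc)
        then have "?s ^ Suc ?c * ?N \<le> ?m"
          using partition_norm_le_moment[OF P assms(1), of p n A] by (simp only: card_last_block_partition)
        then show ?thesis
          using partition_norm_nonneg[OF P assms(1)] assms(2) by (intro divide_right_mono power_mono) auto
      qed
      finally show ?thesis .
    qed
    have "(\<Sum>q\<in>?Q. (a q)\<^sup>2 / 2) = (\<Sum>l\<in>{1..<d}. p / 2 * (\<Sum>k=1..n. (x l k)\<^sup>2))"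
      using assms(2) by (simp add: a_def power_mult_distrib sum_distrib_left sum.cartesian_product case_prod_beta)
    also have "\<dots> \<le> (\<Sum>l\<in>{1..<d}. p / 2 * 1)"
      using assms(2) x by (intro sum_mono mult_left_mono) auto
    finally have KL: "(\<Sum>q\<in>?Q. (a q)\<^sup>2 / 2) \<le> real (d - 1) * p / 2" by simp
    have "(\<Sum>S\<in>Pow {1..<d}. V S) \<le> (\<Sum>S\<in>Pow {1..<d}. ?m\<^sup>2 / p)"
      by (intro sum_mono V_le) auto
    then have "\<kappa>\<^sup>2 / 2 * (\<Sum>S\<in>Pow {1..<d}. V S) \<le> \<kappa>\<^sup>2 / 2 * (2 ^ (d - 1) * (?m\<^sup>2 / p))"
      by (intro mult_left_mono) (simp_all add: card_Pow)
    moreover have "\<kappa> * (\<Sum>i\<in>?I. A i * y (i d) * (\<Prod>l\<in>{1..<d}. a (l, i l))) - \<kappa>\<^sup>2 / 2 * (\<Sum>S\<in>Pow {1..<d}. V S)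
        - (\<Sum>q\<in>?Q. (a q)\<^sup>2 / 2) \<le> Z - 1"
      unfolding Z_def V_def
      by (intro tilt_variational has_bochner_integral_tilt_linear_process assms(1)
          integrable_exp_linear_minus_square prob_space_std_gaussian borel_measurable_linear_process) simp
    moreover have "(\<Sum>i\<in>?I. A i * y (i d) * (\<Prod>l\<in>{1..<d}. a (l, i l)))
        = ?s ^ (d - 1) * (\<Sum>i\<in>?I. A i * y (i d) * (\<Prod>l\<in>{1..<d}. x l (i l)))"
      by (simp add: a_def prod.distrib sum_distrib_left mult_ac)
    ultimately have "\<kappa> * ?s ^ (d - 1) * (\<Sum>i\<in>?I. A i * y (i d) * (\<Prod>l\<in>{1..<d}. x l (i l))) \<le> Z - 1 + c"
      using KL by (simp add: c_def mult_ac)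
    then show "(\<Sum>i\<in>?I. A i * y (i d) * (\<Prod>l\<in>{1..<d}. x l (i l))) \<le> (Z - 1 + c) / (\<kappa> * ?s ^ (d - 1))"
      using D by (simp add: pos_le_divide_eq mult_ac)
  qed
  then show ?thesis
    using D by (simp add: pos_le_divide_eq Z_def c_def mult_ac)
qed

theorem theorem2:
  fixes d :: nat
  assumes "d \<ge> 2"
  shows "\<exists>C>0. \<forall>n\<ge>1. \<forall>A :: (nat \<Rightarrow> nat) \<Rightarrow> real. \<forall>p\<ge>2.
    \<forall>(M :: 'a measure) (g :: nat \<Rightarrow> 'a \<Rightarrow> real).
      prob_space M \<longrightarrow>
      prob_space.indep_vars M (\<lambda>_. borel) g {1..n} \<longrightarrow>
      (\<forall>j\<in>{1..n}. distributed M lborel (g j) std_normal_density) \<longrightarrow>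
      prob_space.expectation M
        (\<lambda>\<omega>. partition_norm n (d - 1) (singletons (d - 1)) (contract_last n d A (\<lambda>j. g j \<omega>)))
      \<le> C * p powr ((1 - real d) / 2) * moment n d p A"
proof (intro exI conjI allI impI)
  \<comment> \<open>The first summand counts the subsets \<open>S\<close> in the second-moment term,
    the second comes from the entropy.\<close>
  define C :: real where "C = (2 ^ (d - 1) + real (d - 1)) / 2"
  show "C > 0" by (simp add: C_def add_pos_nonneg)
  fix n :: nat and A :: "(nat \<Rightarrow> nat) \<Rightarrow> real" and p :: real and M :: "'a measure" and g :: "nat \<Rightarrow> 'a \<Rightarrow> real"
  assume p: "p \<ge> 2" and M: "prob_space M" and indep: "prob_space.indep_vars M (\<lambda>_. borel) g {1..n}"
    and normal: "\<forall>j\<in>{1..n}. distributed M lborel (g j) std_normal_density"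
  interpret prob_space M by fact
  let ?F = "\<lambda>\<omega>. partition_norm n (d - 1) (singletons (d - 1)) (contract_last n d A (\<lambda>j. g j \<omega>))"
  let ?m = "moment n d p A" and ?D = "sqrt p ^ (d - 1)"
  have d: "d \<ge> 1" using assms by simp
  have D: "?D > 0" using p by simp
  have m: "?m \<ge> 0"
  proof -
    note P = partition_on_last_block_partition[OF d, of "{}"]
    have "0 \<le> p powr (real (card (last_block_partition d {})) / 2) * partition_norm n d (last_block_partition d {}) A"
      using partition_norm_nonneg[OF P d] by simp
    then show ?thesis
      using partition_norm_le_moment[OF P d, of p n A] by simp
  qed
  \<comment> \<open>A strict upper bound \<open>b\<close> replaces \<open>?m\<close> so that
    \<open>p / b\<close> makes sense even when \<open>?m = 0\<close>.\<close>
  have bound: "expectation ?F \<le> C / ?D * b" if b: "?m < b" for b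
  proof (cases "integrable M ?F")
    case True
    \<comment> \<open>This choice gives \<open>\<kappa> * ?m \<le> p\<close>, so both terms of
      \<open>c\<close> are of order \<open>p\<close>; dividing \<open>C * p\<close> by
      \<open>\<kappa> * ?D\<close> leaves \<open>C / ?D * b\<close>.\<close>
    define \<kappa> where "\<kappa> = p / b"
    have "b > 0" and \<kappa>: "\<kappa> > 0" using m b p by (auto simp: \<kappa>_def)
    define Z where "Z \<omega> = (\<integral>\<theta>. exp (\<Sum>j=1..n. linear_process n d A \<kappa> j \<theta> * g j \<omega>
        - (linear_process n d A \<kappa> j \<theta>)\<^sup>2 / 2) \<partial>std_gaussian ({1..<d} \<times> {1..n}))" for \<omega>
    define c where "c = \<kappa>\<^sup>2 * 2 ^ (d - 1) * ?m\<^sup>2 / (2 * p) + real (d - 1) * p / 2"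
    have Z: "has_bochner_integral M Z 1"
      unfolding Z_def using normal
      by (intro has_bochner_integral_exp_gaussian_mixture M indep prob_space_std_gaussian
          borel_measurable_linear_process) auto
    have "\<kappa> * ?D * expectation ?F = (\<integral>\<omega>. \<kappa> * ?D * ?F \<omega> \<partial>M)"
      by simp
    also have "\<dots> \<le> (\<integral>\<omega>. Z \<omega> - 1 + c \<partial>M)"
    proof (rule integral_mono)
      show "integrable M (\<lambda>\<omega>. \<kappa> * ?D * ?F \<omega>)"
        by (intro integrable_mult_right True)
      show "integrable M (\<lambda>\<omega>. Z \<omega> - 1 + c)"
        using Z by (simp add: has_bochner_integral_iff)
      show "\<kappa> * ?D * ?F \<omega> \<le> Z \<omega> - 1 + c" for \<omega>
        unfolding Z_def c_def using p by (intro partition_norm_contract_last_le_exp d \<kappa>) simp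
    qed
    also have "\<dots> = c"
      using Z by (simp add: has_bochner_integral_iff prob_space)
    also have "c \<le> C * p"
    proof -
      have "?m\<^sup>2 \<le> b\<^sup>2" using m b by (intro power_mono) auto
      then have "\<kappa>\<^sup>2 * ?m\<^sup>2 \<le> p\<^sup>2"
        using \<open>b > 0\<close> p by (simp add: \<kappa>_def power_divide divide_le_eq mult_left_mono)
      then have "2 ^ (d - 1) * (\<kappa>\<^sup>2 * ?m\<^sup>2) / (2 * p) \<le> 2 ^ (d - 1) * p\<^sup>2 / (2 * p)"
        using p by (intro divide_right_mono mult_left_mono) auto
      then show ?thesis
        using p by (simp add: c_def C_def field_simps power2_eq_square)
    qed
    finally have "\<kappa> * ?D * expectation ?F \<le> C * p" .
    then show ?thesis
      using \<open>b > 0\<close> D p by (simp add: \<kappa>_def field_simps)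
  next
    case False
    \<comment> \<open>the Bochner integral is then \<open>0\<close>, so measurability of the supremum is never needed\<close>
    then show ?thesis
      using m b D \<open>C > 0\<close> by (simp add: not_integrable_integral_eq)
  qed
  have "expectation ?F \<le> C / ?D * ?m"
  proof (rule field_le_epsilon)
    fix e :: real assume "e > 0"
    then have "e * ?D / C > 0" using D \<open>C > 0\<close> by simp
    \<comment> \<open>The excess over \<open>?m\<close> is scaled so that the factor
      \<open>C / ?D\<close> turns it into \<open>e\<close>.\<close>
    then have "expectation ?F \<le> C / ?D * (?m + e * ?D / C)"
      by (intro bound) simp
    also have "\<dots> = C / ?D * ?m + e"
      unfolding distrib_left using D p \<open>C > 0\<close> by simp
    finally show "expectation ?F \<le> C / ?D * ?m + e" .
  qed
  also have "C / ?D = C * p powr ((1 - real d) / 2)"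
  proof -
    have "?D = p powr (real (d - 1) / 2)"
      using p by (simp add: powr_half_sqrt[symmetric] powr_power)
    moreover have "(1 - real d) / 2 = - (real (d - 1) / 2)"
      using d by (simp add: of_nat_diff field_simps)
    ultimately show ?thesis
      by (simp only: powr_minus divide_inverse)
  qed
  finally show "expectation ?F \<le> C * p powr ((1 - real d) / 2) * ?m" .
qed

end
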